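(* For all integers $r > s \geq 1$ there exist positive constants $c_0 = c_0(r,s)$ and $n_0 = n_0(r,s)$ such that the following holds. For all integers $n \geq n_0$ and $1 \leq t \leq c_0 n$ and every $r$-graph $F$ on vertex set $[n]$: (i) if $|F| < N(n,t,r,s)$, then $\mathrm{rk}\, M_s^r(\overline{F}) > \binom{n}{s} - t$; (ii) $|F| = N(n,t,r,s)$ and $\mathrm{rk}\, M_s^r(\overline{F}) \leq \binom{n}{s} - t$ hold if and only if $F$ is the upper $(r-s)$-shadow of an $s$-star configuration of size $t$.
   Context: An $r$-graph on $[n]$ is identified with its edge set, a subset of $\binom{[n]}{r}$; $|F|$ is its number of edges and $\overline{F}$ is its complement, the $r$-graph on $[n]$ with edge set $\binom{[n]}{r} \setminus F$. For an $r$-graph $G$ and $0\le s \le r$, the higher inclusion matrix $M_s^r(G)$ is the $\{0,1\}$-matrix with rows indexed by the edges of $G$ and columns indexed by the $s$-subsets of $V(G)$, the entry for edge $e$ and $s$-set $S$ being $1$ if $S \subseteq e$ and $0$ otherwise; $\mathrm{rk}$ is rank over the reals. $N(n,t,r,s) = \binom{n-s+1}{r-s+1} - \binom{n-s+1-t}{r-s+1}$. A collection of $s$-sets is an $s$-star configuration if the common intersection of all its members has size at least $s-1$. The upper $(r-s)$-shadow of a family $\mathcal{S}$ of $s$-subsets of $[n]$ is the set of all $r$-subsets of $[n]$ containing at least one member of $\mathcal{S}$. *)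

theory Defs
  imports
    Complex_Main
    "HOL-Library.Ramsey"
    "HOL-Library.Nat_Bijection"
    "Jordan_Normal_Form.DL_Rank"
begin

text \<open>
  An \<open>r\<close>-graph on \<open>[n] = {1..n}\<close> is a set of edges \<open>F \<subseteq> nsets {1..n} r\<close>; its complement is
  \<open>nsets {1..n} r - F\<close>.
\<close>

text \<open>
  Matrices have rows and columns numbered from \<open>0\<close>, so the index families have to be listed. The
  binary encoding of finite sets of naturals (colexicographic order) makes this canonical; for a
  finite family of finite sets, every member occurs exactly once. The rank does not depend on the
  order.
\<close>

definition list_family :: "nat set set \<Rightarrow> nat set list" where
  "list_family \<A> = map set_decode (sorted_list_of_set (set_encode ` \<A>))"

lemma set_list_family:
  assumes "finite \<A>" and "\<And>A. A \<in> \<A> \<Longrightarrow> finite A"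
  shows "set (list_family \<A>) = \<A>"
  using assms by (simp add: list_family_def image_image)

lemma distinct_list_family: "distinct (list_family \<A>)"
  by (metis list_family_def distinct_map distinct_sorted_list_of_set inj_onI set_decode_inverse)

definition inclusion_matrix :: "nat \<Rightarrow> nat \<Rightarrow> nat set set \<Rightarrow> real mat" where
  "inclusion_matrix n s G =
     (let rs = list_family G; cs = list_family (nsets {1..n} s)
      in mat (length rs) (length cs) (\<lambda>(i, j). if cs ! j \<subseteq> rs ! i then 1 else 0))"

definition mat_rank :: "real mat \<Rightarrow> nat" where
  "mat_rank A = vec_space.rank (dim_row A) A"

text \<open>
  The subtrahend never exceeds the minuend. The truncated differences are the integer ones for
  \<open>s \<le> n\<close> and \<open>t \<le> n + 1 - s\<close>.
\<close>

definition N :: "nat \<Rightarrow> nat \<Rightarrow> nat \<Rightarrow> nat \<Rightarrow> nat" where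
  "N n t r s = ((n + 1 - s) choose (r + 1 - s)) - ((n + 1 - s - t) choose (r + 1 - s))"

text \<open>
  The empty family is irrelevant here: only configurations of size \<open>t \<ge> 1\<close> are considered.
\<close>

definition star_configuration :: "nat \<Rightarrow> nat \<Rightarrow> nat set set \<Rightarrow> bool" where
  "star_configuration n s \<S> \<longleftrightarrow> \<S> \<subseteq> nsets {1..n} s \<and> card (\<Inter>\<S>) \<ge> s - 1"

definition upper_shadow :: "nat \<Rightarrow> nat \<Rightarrow> nat set set \<Rightarrow> nat set set" where
  "upper_shadow n r \<S> = {e \<in> nsets {1..n} r. \<exists>S\<in>\<S>. S \<subseteq> e}"

end

theory Submission
  imports Defs
begin

text \<open>
  If the rank is at most \<open>n choose s - t\<close>, choose a basis of the column space among the columns.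
  At least \<open>t\<close> columns lie outside it; pick \<open>t\<close> of them as \<open>T\<close>. Each \<open>S \<in> T\<close> yields a kernel vector \<open>w\<^sub>S\<close> that is \<open>1\<close> at \<open>S\<close> and \<open>0\<close> on the
  rest of \<open>T\<close>. Every \<open>r\<close>-set on which some \<open>w\<^sub>S\<close> does not sum to \<open>0\<close> is an edge of \<open>F\<close>. Let
  \<open>H \<supseteq> T\<close> be the union of the supports. Since few edges force \<open>H\<close> to have size \<open>O(t)\<close>, hence at most
  a small multiple of \<open>n\<close>, most \<open>r\<close>-sets containing a given member of \<open>H\<close> contain no other one.
  Such sets are edges, and an \<open>r\<close>-set of the upper shadow of \<open>T\<close> can fail to be an edge only if it
  contains a member of \<open>H - T\<close> together with another member of \<open>H\<close>. So each member of \<open>H - T\<close>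
  contributes more edges than it destroys, and \<open>F\<close> is at least as large as the upper shadow of
  \<open>T\<close>, with equality only for \<open>H = T\<close>.

  It remains to bound the upper shadow of \<open>t\<close> sets. Remove them one by one: if \<open>m\<close> sets are present,
  the removed \<open>S\<close> is the only one contained in at least \<open>n - s - (m - 1) choose (r - s)\<close> of the
  \<open>r\<close>-sets above it, because it suffices to avoid one point of each \<open>S' - S\<close>. Equality forces the
  sets \<open>S' - S\<close> to be distinct singletons for every \<open>S\<close>, that is, a star.
\<close>

section \<open>Injectivity of the inclusion map\<close>

lemma card_nsets: "finite A \<Longrightarrow> card (nsets A k) = card A choose k"
proof -
  assume "finite A"
  moreover from this have "nsets A k = {B. B \<subseteq> A \<and> card B = k}"
    by (auto simp: nsets_def intro: finite_subset)
  ultimately show ?thesis by (simp add: n_subsets)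
qed

lemma finite_nsets [simp]: "finite A \<Longrightarrow> finite (nsets A k)"
  by (rule finite_imp_finite_nsets)

lemma nsets_insert:
  assumes "a \<notin> A"
  shows "nsets (insert a A) (Suc k) = nsets A (Suc k) \<union> insert a ` nsets A k"
proof
  show "nsets (insert a A) (Suc k) \<subseteq> nsets A (Suc k) \<union> insert a ` nsets A k"
  proof
    fix B assume B: "B \<in> nsets (insert a A) (Suc k)"
    show "B \<in> nsets A (Suc k) \<union> insert a ` nsets A k"
    proof (cases "a \<in> B")
      case True
      then have "B = insert a (B - {a})" "B - {a} \<in> nsets A k"
        using B by (auto simp: nsets_def)
      then show ?thesis by blast
    qed (use B in \<open>auto simp: nsets_def\<close>)
  qed
  show "nsets A (Suc k) \<union> insert a ` nsets A k \<subseteq> nsets (insert a A) (Suc k)"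
    using assms by (auto simp: nsets_def card_insert_if)
qed

lemma sum_nsets_insert:
  assumes "a \<notin> A" "finite A"
  shows "sum w (nsets (insert a A) (Suc k)) = sum w (nsets A (Suc k)) + (\<Sum>B\<in>nsets A k. w (insert a B))"
proof -
  have "inj_on (insert a) (nsets A k)"
    using assms(1) by (intro inj_onI) (auto simp: nsets_def)
  moreover have "nsets A (Suc k) \<inter> insert a ` nsets A k = {}"
    using assms(1) by (auto simp: nsets_def)
  ultimately show ?thesis
    using assms by (simp add: nsets_insert sum.union_disjoint sum.reindex o_def)
qed

text \<open>Induction on the size of \<open>S - S'\<close>: exchanging a point of
  \<open>S - S'\<close> for one of \<open>S' - S\<close> keeps the weight and brings
  \<open>S\<close> one point closer to \<open>S'\<close>.\<close>

lemma exchange_invariant_constant: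
  assumes swap: "\<And>a b B. a \<in> X \<Longrightarrow> b \<in> X \<Longrightarrow> a \<noteq> b \<Longrightarrow> B \<in> nsets (X - {a, b}) k \<Longrightarrow>
      w (insert a B) = w (insert b B)"
    and "S \<in> nsets X (Suc k)" "S' \<in> nsets X (Suc k)"
  shows "w S = w S'"
  using assms(2)
proof (induction "card (S - S')" arbitrary: S)
  case 0
  then have "S \<subseteq> S'" by (auto simp: nsets_def)
  then have "S = S'" using 0 assms(3) by (intro card_subset_eq) (auto simp: nsets_def)
  then show ?case by simp
next
  case (Suc m)
  have fin: "finite S" "finite S'" and card: "card S = Suc k" "card S' = Suc k"
    and sub: "S \<subseteq> X" "S' \<subseteq> X"
    using Suc.prems assms(3) by (auto simp: nsets_def)
  obtain a where a: "a \<in> S" "a \<notin> S'"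
    using Suc.hyps(2) by (metis Diff_eq_empty_iff card.empty nat.distinct(1) subsetI)
  have "card (S' - S) = card (S - S')"
    using fin card by (simp add: card_Diff_subset_Int Int_commute)
  then obtain b where b: "b \<in> S'" "b \<notin> S"
    using Suc.hyps(2) by (metis Diff_eq_empty_iff card.empty nat.distinct(1) subsetI)
  let ?B = "S - {a}"
  have "w (insert a ?B) = w (insert b ?B)"
    using a b fin card sub by (intro swap) (auto simp: nsets_def)
  moreover have "insert a ?B = S" using a by blast
  moreover have "w (insert b ?B) = w S'"
  proof (rule Suc.hyps(1))
    have "insert b ?B - S' = (S - S') - {a}" using b by blast
    then show "m = card (insert b ?B - S')" using Suc.hyps(2) a fin by simp
    show "insert b ?B \<in> nsets X (Suc k)"
      using a b fin card sub by (auto simp: nsets_def)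
  qed
  ultimately show ?case by simp
qed

text \<open>
  Replacing \<open>a\<close> by \<open>b\<close> in an \<open>r\<close>-set and subtracting lowers both \<open>r\<close> and \<open>s\<close> by one, so by
  induction the weight is invariant under exchanges, hence constant.
\<close>

lemma inclusion_matrix_injective:
  fixes w :: "'a set \<Rightarrow> real"
  assumes "finite X" "r + s \<le> card X" "s \<le> r"
    and "\<And>e. e \<in> nsets X r \<Longrightarrow> sum w (nsets e s) = 0"
    and "S \<in> nsets X s"
  shows "w S = 0"
  using assms
proof (induction s arbitrary: r X w S)
  case 0
  then obtain e where "e \<in> nsets X r"
    using nsets_eq_empty_iff[of X r] by fastforce
  with 0 show ?case by fastforce
next
  case (Suc s)
  then obtain q where r: "r = Suc q" by (cases r) auto
  have swap: "w (insert a B) = w (insert b B)"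
    if ab: "a \<in> X" "b \<in> X" "a \<noteq> b" and B: "B \<in> nsets (X - {a, b}) s" for a b B
  proof -
    have "w (insert a B) - w (insert b B) = 0"
    proof (rule Suc.IH[where w = "\<lambda>B. w (insert a B) - w (insert b B)" and X = "X - {a, b}" and r = q])
      show "finite (X - {a, b})" "s \<le> q" using Suc.prems r by auto
      \<comment> \<open>Two points leave \<open>X\<close>, while \<open>q + s\<close> is also two
        less than \<open>r + Suc s\<close>, so the size hypothesis carries over exactly.\<close>
      have "card (X - {a, b}) = card X - 2" using ab Suc.prems by (simp add: card_Diff_subset)
      then show "q + s \<le> card (X - {a, b})" using Suc.prems r by simp
      show "B \<in> nsets (X - {a, b}) s" by fact
      fix e assume e: "e \<in> nsets (X - {a, b}) q"
      have "insert a e \<in> nsets X r" "insert b e \<in> nsets X r" and ne: "a \<notin> e" "b \<notin> e" "finite e"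
        using e ab r by (auto simp: nsets_def card_insert_if)
      then have "sum w (nsets (insert a e) (Suc s)) = sum w (nsets (insert b e) (Suc s))"
        using Suc.prems(4) by simp
      \<comment> \<open>After splitting off the subsets through \<open>a\<close> and through
        \<open>b\<close>, the \<open>Suc s\<close>-subsets of \<open>e\<close> itself appear on both
        sides and cancel.\<close>
      then show "(\<Sum>B\<in>nsets e s. w (insert a B) - w (insert b B)) = 0"
        using ne by (simp add: sum_nsets_insert sum_subtractf)
    qed
    then show ?thesis by simp
  qed
  obtain e where e: "e \<in> nsets X r"
    using Suc.prems nsets_eq_empty_iff[of X r] by fastforce
  have "w S' = w S" if "S' \<in> nsets e (Suc s)" for S'
  proof (rule exchange_invariant_constant[where w = w and X = X and k = s])
    show "S' \<in> nsets X (Suc s)" using that e by (auto simp: nsets_def)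
  qed (use Suc.prems swap in auto)
  then have "sum w (nsets e (Suc s)) = card (nsets e (Suc s)) * w S" by simp
  moreover have "card (nsets e (Suc s)) \<noteq> 0"
    using e card_nsets[of e "Suc s"] Suc.prems by (auto simp: nsets_def)
  ultimately show ?case using Suc.prems(4)[OF e] by (metis mult_eq_0_iff of_nat_eq_0_iff)
qed

section \<open>Column bases of inclusion matrices\<close>

lemma (in vec_space) maximal_indpt_cols:
  obtains U where "maximal U (\<lambda>T. T \<subseteq> set (cols A) \<and> lin_indpt T)"
  using maximal_exists[of "(\<lambda>T. T \<subseteq> set (cols A) \<and> lin_indpt T)" "card (set (cols A))" "{}"]
  by (meson List.finite_set card_mono empty_iff empty_subsetI finite_lin_indpt2 rev_finite_subset)

lemma (in vec_space) maximal_indpt_spans: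
  assumes C: "C \<subseteq> carrier_vec n" "finite C" and U: "maximal U (\<lambda>T. T \<subseteq> C \<and> lin_indpt T)"
  shows "C \<subseteq> span U"
proof
  fix v assume v: "v \<in> C"
  have U': "U \<subseteq> C" "lin_indpt U" using U by (auto simp: maximal_def)
  show "v \<in> span U"
  proof (rule ccontr)
    assume no: "v \<notin> span U"
    then have "v \<notin> U" using U' C in_own_span by blast
    then have "lin_indpt (U \<union> {v})"
      using no U' C v by (meson lin_dep_iff_in_span subset_trans subsetD)
    then have "U \<union> {v} \<subseteq> C \<and> lin_indpt (U \<union> {v})" using U' v by simp
    then show False using U \<open>v \<notin> U\<close> unfolding maximal_def by blast
  qed
qed

text \<open>Equal columns collapse in \<open>set (cols A)\<close>. The maximal independent set
  \<open>U\<close> is therefore lifted to a set \<open>J\<close> of indices on which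
  \<open>col A\<close> is injective, so that \<open>card J\<close> is still the rank.\<close>

lemma (in vec_space) rank_col_basis:
  assumes A: "A \<in> carrier_mat n nc"
  obtains J where "J \<subseteq> {..<nc}" "card J = rank A"
    "\<And>j. j < nc \<Longrightarrow> \<exists>a. \<forall>i<n. A $$ (i, j) = (\<Sum>k\<in>J. a k * A $$ (i, k))"
proof -
  obtain U where U: "maximal U (\<lambda>T. T \<subseteq> set (cols A) \<and> lin_indpt T)"
    by (rule maximal_indpt_cols)
  have Usub: "U \<subseteq> set (cols A)" using U by (simp add: maximal_def)
  have C: "set (cols A) \<subseteq> carrier_vec n" using A cols_dim by blast
  have set_cols: "set (cols A) = col A ` {..<nc}" using A by (auto simp: cols_def)
  obtain J where J: "J \<subseteq> {..<nc}" "inj_on (col A) J" "U = col A ` J"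
    using Usub set_cols by (metis subset_image_inj)
  show thesis
  proof (rule that)
    show "card J = rank A"
      using rank_card_indpt[OF A U] J by (simp add: card_image)
    fix j assume j: "j < nc"
    then have "col A j \<in> span U"
      using maximal_indpt_spans[OF C _ U] set_cols by auto
    then obtain a where a: "col A j = lincomb a U"
      using finite_in_span[of U "col A j"] Usub C
      by (metis List.finite_set finite_subset order_trans)
    have "A $$ (i, j) = (\<Sum>k\<in>J. a (col A k) * A $$ (i, k))" if i: "i < n" for i
    proof -
      have "A $$ (i, j) = (\<Sum>x\<in>U. a x * x $ i)"
        using lincomb_index[OF i, of U a] a A i j Usub C by (metis carrier_matD index_col subset_trans)
      also have "\<dots> = (\<Sum>k\<in>J. a (col A k) * col A k $ i)"
        using J by (simp add: sum.reindex)
      also have "\<dots> = (\<Sum>k\<in>J. a (col A k) * A $$ (i, k))"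
        using J A i by (intro sum.cong) auto
      finally show ?thesis .
    qed
    then show "\<exists>a. \<forall>i<n. A $$ (i, j) = (\<Sum>k\<in>J. a k * A $$ (i, k))"
      by (intro exI[of _ "\<lambda>k. a (col A k)"]) blast
  qed (fact J(1))
qed

text \<open>An independent set of columns cannot contain the zero vector. This serves the converse
  direction, where a star makes columns vanish.\<close>

lemma (in vec_space) rank_le_nonzero_cols:
  assumes A: "A \<in> carrier_mat n nc"
  shows "rank A \<le> card {j. j < nc \<and> col A j \<noteq> 0\<^sub>v n}"
proof -
  obtain U where U: "maximal U (\<lambda>T. T \<subseteq> set (cols A) \<and> lin_indpt T)"
    by (rule maximal_indpt_cols)
  have Usub: "U \<subseteq> set (cols A)" "lin_indpt U" using U by (simp_all add: maximal_def)
  have set_cols: "set (cols A) = col A ` {..<nc}" using A by (auto simp: cols_def)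
  have C: "set (cols A) \<subseteq> carrier_vec n" using A cols_dim by blast
  have U_carrier: "U \<subseteq> carrier_vec n" by (rule order_trans[OF Usub(1) C])
  have "(1 :: 'a) \<in> UNIV" "(1 :: 'a) \<notin> {0}" by simp_all
  then have nontrivial: "(UNIV :: 'a set) \<noteq> {0}" by metis
  have nz: "0\<^sub>v n \<notin> U" using Usub(2) zero_nin_lin_indpt[OF U_carrier] nontrivial by simp
  have "U \<subseteq> col A ` {j. j < nc \<and> col A j \<noteq> 0\<^sub>v n}"
  proof
    fix x assume x: "x \<in> U"
    then have "x \<in> col A ` {..<nc}" using Usub(1) set_cols by (simp add: subset_iff)
    then obtain j where j: "j < nc" "x = col A j" by (rule imageE) simp
    then have "col A j \<noteq> 0\<^sub>v n" using x nz by metis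
    then show "x \<in> col A ` {j. j < nc \<and> col A j \<noteq> 0\<^sub>v n}" using j by (simp add: imageI)
  qed
  then have "card U \<le> card {j. j < nc \<and> col A j \<noteq> 0\<^sub>v n}"
    by (rule surj_card_le[rotated]) simp
  then show ?thesis using rank_card_indpt[OF A U] by simp
qed

section \<open>Inclusion matrices with columns named by \<open>s\<close>-sets instead of list
  positions\<close>

lemma list_family_index:
  assumes "finite \<A>" "\<And>A. A \<in> \<A> \<Longrightarrow> finite A"
  shows "bij_betw (\<lambda>i. list_family \<A> ! i) {..<length (list_family \<A>)} \<A>"
  using bij_betw_nth[OF distinct_list_family, of _ \<A>] set_list_family[OF assms] by simp

lemma inclusion_matrix_col_basis:
  assumes G: "finite G" "\<And>e. e \<in> G \<Longrightarrow> finite e"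
  obtains B where "B \<subseteq> nsets {1..n} s" "card B = mat_rank (inclusion_matrix n s G)"
    "\<And>S. S \<in> nsets {1..n} s \<Longrightarrow>
      \<exists>a. \<forall>e\<in>G. of_bool (S \<subseteq> e) = (\<Sum>S'\<in>B. a S' * of_bool (S' \<subseteq> e) :: real)"
proof -
  let ?rs = "list_family G" and ?cs = "list_family (nsets {1..n} s)"
  let ?A = "inclusion_matrix n s G"
  have A: "?A \<in> carrier_mat (length ?rs) (length ?cs)"
    by (simp add: inclusion_matrix_def Let_def)
  have rank: "mat_rank ?A = vec_space.rank (length ?rs) ?A"
    using A by (simp add: mat_rank_def inclusion_matrix_def Let_def)
  have entry: "?A $$ (i, j) = of_bool (?cs ! j \<subseteq> ?rs ! i)" if "i < length ?rs" "j < length ?cs" for i j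
    using that by (simp add: inclusion_matrix_def Let_def)
  have bcs: "bij_betw (\<lambda>j. ?cs ! j) {..<length ?cs} (nsets {1..n} s)"
    by (rule list_family_index) (auto simp: nsets_def intro: finite_subset)
  have brs: "bij_betw (\<lambda>j. ?rs ! j) {..<length ?rs} G"
    by (rule list_family_index) (use G in auto)
  obtain J where J: "J \<subseteq> {..<length ?cs}" "card J = mat_rank ?A"
    "\<And>j. j < length ?cs \<Longrightarrow> \<exists>a. \<forall>i<length ?rs. ?A $$ (i, j) = (\<Sum>k\<in>J. a k * ?A $$ (i, k))"
    using vec_space.rank_col_basis[OF A] rank by metis
  have inj: "inj_on (\<lambda>j. ?cs ! j) J"
    using bcs J(1) by (auto simp: bij_betw_def intro: inj_on_subset)
  \<comment> \<open>\<open>ix\<close> recovers the position of a basis set, so that coefficients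
    attached to positions become coefficients attached to sets.\<close>
  define ix where "ix = the_inv_into J (\<lambda>j. ?cs ! j)"
  show thesis
  proof (rule that)
    show "(\<lambda>j. ?cs ! j) ` J \<subseteq> nsets {1..n} s" using bcs J(1) by (auto simp: bij_betw_def)
    show "card ((\<lambda>j. ?cs ! j) ` J) = mat_rank ?A" using J(2) inj by (simp add: card_image)
    fix S assume "S \<in> nsets {1..n} s"
    then obtain j where j: "j < length ?cs" "S = ?cs ! j" using bcs by (auto simp: bij_betw_def)
    from J(3)[OF j(1)] obtain a where a: "\<forall>i<length ?rs. ?A $$ (i, j) = (\<Sum>k\<in>J. a k * ?A $$ (i, k))" ..
    have "of_bool (S \<subseteq> e) = (\<Sum>S'\<in>(\<lambda>j. ?cs ! j) ` J. a (ix S') * of_bool (S' \<subseteq> e))" if "e \<in> G" for e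
    proof -
      have "e \<in> (\<lambda>i. ?rs ! i) ` {..<length ?rs}" using brs that by (simp add: bij_betw_def)
      then obtain i where i: "i < length ?rs" "e = ?rs ! i" by (rule imageE) simp
      have "of_bool (S \<subseteq> e) = (\<Sum>k\<in>J. a k * ?A $$ (i, k))"
        unfolding i(2) j(2) entry[OF i(1) j(1), symmetric] by (rule a[rule_format, OF i(1)])
      also have "\<dots> = (\<Sum>k\<in>J. a k * of_bool (?cs ! k \<subseteq> e))"
      proof (rule sum.cong)
        fix k assume "k \<in> J"
        then have "k < length ?cs" using J(1) by (simp add: subset_iff)
        then show "a k * ?A $$ (i, k) = a k * of_bool (?cs ! k \<subseteq> e)"
          by (simp only: entry[OF i(1)] i(2))
      qed simp
      also have "\<dots> = (\<Sum>S'\<in>(\<lambda>j. ?cs ! j) ` J. a (ix S') * of_bool (S' \<subseteq> e))"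
        using inj by (simp add: sum.reindex ix_def the_inv_into_f_f)
      finally show ?thesis .
    qed
    then show "\<exists>a. \<forall>e\<in>G. of_bool (S \<subseteq> e) = (\<Sum>S'\<in>(\<lambda>j. ?cs ! j) ` J. a S' * of_bool (S' \<subseteq> e) :: real)"
      by (intro exI[of _ "\<lambda>S'. a (ix S')"] ballI)
  qed
qed

text \<open>The columns belonging to \<open>T\<close> are zero, so at most the remaining ones count
  towards the rank.\<close>

lemma inclusion_matrix_rank_le:
  assumes G: "finite G" "\<And>e. e \<in> G \<Longrightarrow> finite e"
    and T: "T \<subseteq> nsets {1..n} s" "\<And>S e. S \<in> T \<Longrightarrow> e \<in> G \<Longrightarrow> \<not> S \<subseteq> e"
  shows "mat_rank (inclusion_matrix n s G) + card T \<le> n choose s"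
proof -
  let ?rs = "list_family G" and ?cs = "list_family (nsets {1..n} s)"
  let ?A = "inclusion_matrix n s G"
  have A: "?A \<in> carrier_mat (length ?rs) (length ?cs)"
    by (simp add: inclusion_matrix_def Let_def)
  have bcs: "bij_betw (\<lambda>j. ?cs ! j) {..<length ?cs} (nsets {1..n} s)"
    by (rule list_family_index) (auto simp: nsets_def intro: finite_subset)
  have rows: "?rs ! i \<in> G" if "i < length ?rs" for i
    using list_family_index[OF G] that by (auto simp: bij_betw_def)
  let ?J = "{j. j < length ?cs \<and> col ?A j \<noteq> 0\<^sub>v (length ?rs)}"
  have "mat_rank ?A \<le> card ?J"
    using vec_space.rank_le_nonzero_cols[OF A] A by (simp add: mat_rank_def inclusion_matrix_def Let_def)
  also have "\<dots> = card ((\<lambda>j. ?cs ! j) ` ?J)"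
    using bcs by (intro card_image[symmetric]) (auto simp: bij_betw_def intro: inj_on_subset)
  also have "\<dots> \<le> card (nsets {1..n} s - T)"
  proof (rule card_mono)
    show "(\<lambda>j. ?cs ! j) ` ?J \<subseteq> nsets {1..n} s - T"
    proof clarify
      fix j assume j: "j < length ?cs" and nz: "col ?A j \<noteq> 0\<^sub>v (length ?rs)"
      have "?cs ! j \<notin> T"
      proof
        assume "?cs ! j \<in> T"
        then have "col ?A j = 0\<^sub>v (length ?rs)"
          using j T(2) rows by (intro eq_vecI) (auto simp: inclusion_matrix_def Let_def)
        then show False using nz by simp
      qed
      then show "?cs ! j \<in> nsets {1..n} s - T" using bcs j by (auto simp: bij_betw_def)
    qed
  qed simp
  finally show ?thesis
    using T(1) card_mono[OF _ T(1)] by (simp add: card_Diff_subset finite_subset card_nsets)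
qed

text \<open>Moving the basis expansion of the column \<open>S\<close> to one side gives a kernel
  vector supported on \<open>insert S B\<close>. Since \<open>T\<close> is disjoint from
  \<open>B\<close>, its only nonzero entry on \<open>T\<close> is the one at
  \<open>S\<close>.\<close>

lemma inclusion_matrix_kernel:
  assumes F: "F \<subseteq> nsets {1..n} r"
    and t: "mat_rank (inclusion_matrix n s (nsets {1..n} r - F)) + t \<le> n choose s"
  obtains T w where "T \<subseteq> nsets {1..n} s" "card T = t"
    "\<And>S. S \<in> T \<Longrightarrow> w S S = (1::real)"
    "\<And>S S'. S \<in> T \<Longrightarrow> S' \<in> T - {S} \<Longrightarrow> w S S' = 0"
    "\<And>S e. S \<in> T \<Longrightarrow> e \<in> nsets {1..n} r - F \<Longrightarrow> sum (w S) (nsets e s) = 0"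
proof -
  let ?G = "nsets {1..n} r - F" and ?V = "nsets {1..n} s"
  have G: "finite ?G" "\<And>e. e \<in> ?G \<Longrightarrow> finite e" by (auto simp: nsets_def)
  obtain B where B: "B \<subseteq> ?V" "card B = mat_rank (inclusion_matrix n s ?G)"
    and span: "\<And>S. S \<in> ?V \<Longrightarrow>
      \<exists>a. \<forall>e\<in>?G. of_bool (S \<subseteq> e) = (\<Sum>S'\<in>B. a S' * of_bool (S' \<subseteq> e) :: real)"
    by (rule inclusion_matrix_col_basis[OF G(1), of n s]) (assumption | rule G(2) that)+
  have finV: "finite ?V" by simp
  then have finB: "finite B" using B(1) finite_subset by blast
  have "t \<le> card (?V - B)" using B t finB by (simp add: card_Diff_subset card_nsets)
  then obtain T where T: "T \<subseteq> ?V - B" "card T = t" using obtain_subset_with_card_n by metis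
  define a where "a S = (SOME a. \<forall>e\<in>?G. of_bool (S \<subseteq> e) = (\<Sum>S'\<in>B. a S' * of_bool (S' \<subseteq> e) :: real))" for S
  have a: "of_bool (S \<subseteq> e) = (\<Sum>S'\<in>B. a S S' * of_bool (S' \<subseteq> e))" if "S \<in> ?V" "e \<in> ?G" for S e
    using someI_ex[OF span[OF that(1)]] that(2) unfolding a_def by blast
  define w where "w S S' = (if S' = S then 1 else if S' \<in> B then - a S S' else 0)" for S S'
  show thesis
  proof (rule that[of T w])
    show "T \<subseteq> ?V" "card T = t" using T by auto
    fix S assume S: "S \<in> T"
    then have SV: "S \<in> ?V" "S \<notin> B" using T(1) by auto
    show "w S S = 1" by (simp add: w_def)
    show "w S S' = 0" if "S' \<in> T - {S}" for S' using that T(1) by (auto simp: w_def)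
    fix e assume e: "e \<in> ?G"
    then have sub: "nsets e s = {S' \<in> ?V. S' \<subseteq> e}" by (auto simp: nsets_def)
    have "sum (w S) (nsets e s) = (\<Sum>S'\<in>?V. w S S' * of_bool (S' \<subseteq> e))"
      unfolding sub using finV by (simp add: sum.inter_filter of_bool_def if_distrib cong: if_cong)
    also have "\<dots> = (\<Sum>S'\<in>insert S B. w S S' * of_bool (S' \<subseteq> e))"
      using finV SV B(1) by (intro sum.mono_neutral_right) (auto simp: w_def)
    also have "\<dots> = of_bool (S \<subseteq> e) + (\<Sum>S'\<in>B. w S S' * of_bool (S' \<subseteq> e))"
      using finB SV by (simp add: w_def)
    also have "(\<Sum>S'\<in>B. w S S' * of_bool (S' \<subseteq> e)) = (\<Sum>S'\<in>B. - (a S S' * of_bool (S' \<subseteq> e)))"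
      using SV by (intro sum.cong) (auto simp: w_def)
    also have "of_bool (S \<subseteq> e) + \<dots> = 0" using a[OF SV(1) e] by (simp add: sum_negf)
    finally show "sum (w S) (nsets e s) = 0" .
  qed
qed

section \<open>Upper shadows and stars\<close>

lemma choose_strict_mono:
  assumes "a < b" "1 \<le> k" "k \<le> b"
  shows "a choose k < b choose k"
proof -
  obtain c j where c: "b = Suc c" "k = Suc j" using assms by (cases b; cases k) auto
  have "a choose k \<le> c choose k" using assms c by (intro binomial_right_mono) simp
  also have "\<dots> < b choose k" using assms c by simp
  finally show ?thesis .
qed

text \<open>Deleting \<open>S\<close> is a bijection onto the sets of the link, with inverse adding
  \<open>S\<close>. The parameter \<open>P\<close> lets one count cover all supersets as well as
  those avoiding or containing other members.\<close>

lemma card_extensions: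
  assumes V: "finite V" and S: "S \<subseteq> V" "card S \<le> r"
  shows "card {e \<in> nsets V r. S \<subseteq> e \<and> P (e - S)} = card {Z \<in> nsets (V - S) (r - card S). P Z}"
proof (rule bij_betw_same_card)
  have fS: "finite S" using V S finite_subset by blast
  show "bij_betw (\<lambda>e. e - S) {e \<in> nsets V r. S \<subseteq> e \<and> P (e - S)} {Z \<in> nsets (V - S) (r - card S). P Z}"
  proof (rule bij_betw_byWitness[where f' = "\<lambda>Z. S \<union> Z"])
    show "(\<lambda>e. e - S) ` {e \<in> nsets V r. S \<subseteq> e \<and> P (e - S)} \<subseteq> {Z \<in> nsets (V - S) (r - card S). P Z}"
      using fS by (auto simp: nsets_def card_Diff_subset)
    show "(\<lambda>Z. S \<union> Z) ` {Z \<in> nsets (V - S) (r - card S). P Z} \<subseteq> {e \<in> nsets V r. S \<subseteq> e \<and> P (e - S)}"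
    proof clarify
      fix Z assume Z: "Z \<in> nsets (V - S) (r - card S)" "P Z"
      then have "S \<inter> Z = {}" "finite Z" "Z \<subseteq> V" "card Z = r - card S" by (auto simp: nsets_def)
      moreover from this have "S \<union> Z - S = Z" by blast
      ultimately show "S \<union> Z \<in> nsets V r \<and> S \<subseteq> S \<union> Z \<and> P (S \<union> Z - S)"
        using S fS Z by (auto simp: nsets_def card_Un_disjoint)
    qed
  qed (auto simp: nsets_def)
qed

lemma card_supersets:
  assumes "finite V" "S \<in> nsets V s" "s \<le> r"
  shows "card {e \<in> nsets V r. S \<subseteq> e} = (card V - s) choose (r - s)"
proof -
  have S: "S \<subseteq> V" "card S = s" "finite S" using assms(2) by (auto simp: nsets_def)
  then show ?thesis
    using card_extensions[of V S r "\<lambda>_. True"] assms by (simp add: card_nsets card_Diff_subset)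
qed

section \<open>Counting \<open>k\<close>-sets that avoid or contain given nonempty sets\<close>

lemma card_avoiding_ge:
  assumes "finite Y" "finite I" "\<And>i. i \<in> I \<Longrightarrow> D i \<noteq> {}"
  shows "(card Y - card I) choose k \<le> card {Z \<in> nsets Y k. \<forall>i\<in>I. \<not> D i \<subseteq> Z}"
proof -
  \<comment> \<open>Missing one representative of each \<open>D i\<close> is enough to avoid them
    all. Representatives may coincide or lie outside \<open>Y\<close>, which only leaves more
    room.\<close>
  define f where "f i = (SOME x. x \<in> D i)" for i
  have f: "f i \<in> D i" if "i \<in> I" for i
    using assms(3)[OF that] by (simp add: f_def some_in_eq)
  have "card Y - card I \<le> card (Y - f ` I)"
    using diff_card_le_card_Diff[of "f ` I" Y] card_image_le[OF assms(2), of f] assms by simp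
  then have "(card Y - card I) choose k \<le> card (nsets (Y - f ` I) k)"
    using assms by (simp add: card_nsets binomial_right_mono)
  also have "\<dots> \<le> card {Z \<in> nsets Y k. \<forall>i\<in>I. \<not> D i \<subseteq> Z}"
    using assms f by (intro card_mono) (auto simp: nsets_def)
  finally show ?thesis .
qed

lemma avoiding_extremal:
  assumes fin: "finite Y" "finite I" and ne: "\<And>i. i \<in> I \<Longrightarrow> D i \<noteq> {}"
    and k: "1 \<le> k" "card I + k \<le> card Y"
    and le: "card {Z \<in> nsets Y k. \<forall>i\<in>I. \<not> D i \<subseteq> Z} \<le> (card Y - card I) choose k"
  shows "\<forall>i\<in>I. is_singleton (D i)" "inj_on D I"
proof -
  let ?Av = "{Z \<in> nsets Y k. \<forall>i\<in>I. \<not> D i \<subseteq> Z}"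
  \<comment> \<open>If representatives coincide or leave \<open>Y\<close>, fewer than
    \<open>card I\<close> points of \<open>Y\<close> are forbidden, and strictly more
    \<open>k\<close>-sets survive than equality allows.\<close>
  have transversal: "inj_on f I \<and> f ` I \<subseteq> Y" if f: "\<And>i. i \<in> I \<Longrightarrow> f i \<in> D i" for f
  proof (rule ccontr)
    assume contr: "\<not> (inj_on f I \<and> f ` I \<subseteq> Y)"
    have "card (f ` I \<inter> Y) < card I"
    proof (cases "inj_on f I")
      case True
      then have "card (f ` I \<inter> Y) < card (f ` I)"
        using contr fin by (intro psubset_card_mono) auto
      then show ?thesis using True by (simp add: card_image)
    next
      case False
      then have "card (f ` I) < card I"
        using fin card_image_le[of I f] eq_card_imp_inj_on[of I f] by linarith
      moreover have "card (f ` I \<inter> Y) \<le> card (f ` I)" using fin by (intro card_mono) auto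
      ultimately show ?thesis by simp
    qed
    moreover have "card (Y - f ` I) = card Y - card (f ` I \<inter> Y)"
      using fin by (metis Int_commute card_Diff_subset_Int finite_Int)
    ultimately have "card Y - card I < card (Y - f ` I)" "k \<le> card (Y - f ` I)" using k by auto
    then have "(card Y - card I) choose k < card (nsets (Y - f ` I) k)"
      using fin k by (simp add: card_nsets choose_strict_mono)
    also have "\<dots> \<le> card ?Av"
      using fin f by (intro card_mono) (auto simp: nsets_def)
    finally show False using le by simp
  qed
  define f where "f i = (SOME x. x \<in> D i)" for i
  have f: "f i \<in> D i" if "i \<in> I" for i
    using ne[OF that] by (simp add: f_def some_in_eq)
  have single: "D i = {x}" if i: "i \<in> I" and x: "x \<in> D i" for i x
  proof (rule ccontr)
    assume "D i \<noteq> {x}"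
    then obtain y where y: "y \<in> D i" "y \<noteq> x" using x by blast
    define g where "g = f(i := x)"
    have g: "\<And>j. j \<in> I \<Longrightarrow> g j \<in> D j" using f x by (auto simp: g_def)
    have gI: "inj_on g I" "g ` I \<subseteq> Y" using transversal[of g] g by auto
    then have "card (Y - g ` I) = card Y - card I"
      using fin by (simp add: card_Diff_subset card_image)
    \<comment> \<open>Excluding \<open>y\<close> costs at most one point, which leaves enough to
      complete \<open>x\<close> to a \<open>k\<close>-set. That set avoids \<open>D i\<close> by
      missing \<open>y\<close> and each other \<open>D j\<close> by missing \<open>g j\<close>, yet
      it contains the representative \<open>x\<close>, so it was not counted before.\<close>
    then have "k - 1 \<le> card (Y - g ` I - {y})"
      using k fin by (cases "y \<in> Y - g ` I") (auto simp: card_Diff_singleton_if)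
    then obtain Z where Z: "Z \<subseteq> Y - g ` I - {y}" "card Z = k - 1" "finite Z"
      using obtain_subset_with_card_n by metis
    have gi: "g i = x" by (simp add: g_def)
    have x': "x \<in> g ` I" "x \<in> Y" using i gI gi by (metis imageI subsetD)+
    have xZ: "insert x Z \<in> ?Av"
    proof -
      have "insert x Z \<in> nsets Y k" using Z x' k by (auto simp: nsets_def card_insert_if)
      moreover have "\<not> D j \<subseteq> insert x Z" if j: "j \<in> I" for j
      proof (cases "j = i")
        case True
        then show ?thesis using y Z by auto
      next
        case False
        then have "g j \<noteq> x" using gI(1) i j gi by (metis inj_onD)
        moreover have "g j \<notin> Z" using Z j by auto
        ultimately show ?thesis using g[OF j] by auto
      qed
      ultimately show ?thesis by simp
    qed
    have "(card Y - card I) choose k = card (nsets (Y - g ` I) k)"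
      using \<open>card (Y - g ` I) = card Y - card I\<close> fin by (simp add: card_nsets)
    also have "\<dots> < card ?Av"
    proof (intro psubset_card_mono)
      have "insert x Z \<notin> nsets (Y - g ` I) k" using x' by (auto simp: nsets_def)
      moreover have "nsets (Y - g ` I) k \<subseteq> ?Av" using g by (auto simp: nsets_def)
      ultimately show "nsets (Y - g ` I) k \<subset> ?Av" using xZ by blast
    qed (use fin in auto)
    finally show False using le by simp
  qed
  show "\<forall>i\<in>I. is_singleton (D i)"
    using single f by (metis is_singletonI)
  show "inj_on D I"
    using transversal[of f] f single by (intro inj_onI) (metis inj_onD singletonD)
qed

lemma card_hitting_le:
  assumes "finite Y" "finite I" "\<And>i. i \<in> I \<Longrightarrow> D i \<noteq> {}" "1 \<le> k"
  shows "card {Z \<in> nsets Y k. \<exists>i\<in>I. D i \<subseteq> Z} \<le> card I * ((card Y - 1) choose (k - 1))"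
proof -
  define f where "f i = (SOME x. x \<in> D i)" for i
  have f: "f i \<in> D i" if "i \<in> I" for i
    using assms(3)[OF that] by (simp add: f_def some_in_eq)
  have "{Z \<in> nsets Y k. \<exists>i\<in>I. D i \<subseteq> Z} \<subseteq> (\<Union>i\<in>I. {Z \<in> nsets Y k. f i \<in> Z})"
    using f by blast
  then have "card {Z \<in> nsets Y k. \<exists>i\<in>I. D i \<subseteq> Z} \<le> card (\<Union>i\<in>I. {Z \<in> nsets Y k. f i \<in> Z})"
    using assms by (intro card_mono) auto
  also have "\<dots> \<le> (\<Sum>i\<in>I. card {Z \<in> nsets Y k. f i \<in> Z})"
    by (rule card_UN_le) fact
  also have "\<dots> \<le> (\<Sum>i\<in>I. (card Y - 1) choose (k - 1))"
  proof (rule sum_mono)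
    fix i
    show "card {Z \<in> nsets Y k. f i \<in> Z} \<le> (card Y - 1) choose (k - 1)"
    proof (cases "f i \<in> Y")
      case True
      then show ?thesis
        using card_supersets[of Y "{f i}" 1 k] assms by (simp add: nsets_def)
    next
      case False
      then have "{Z \<in> nsets Y k. f i \<in> Z} = {}" by (auto simp: nsets_def)
      then show ?thesis by (metis card.empty le0)
    qed
  qed
  finally show ?thesis by simp
qed

section \<open>Sets above exactly one, or more than one, member of a family\<close>

definition private_edges :: "'a set \<Rightarrow> nat \<Rightarrow> 'a set set \<Rightarrow> 'a set \<Rightarrow> 'a set set" where
  "private_edges V r \<A> S = {e \<in> nsets V r. S \<subseteq> e \<and> (\<forall>S'\<in>\<A> - {S}. \<not> S' \<subseteq> e)}"

definition shared_edges :: "'a set \<Rightarrow> nat \<Rightarrow> 'a set set \<Rightarrow> 'a set \<Rightarrow> 'a set set" where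
  "shared_edges V r \<A> S = {e \<in> nsets V r. S \<subseteq> e \<and> (\<exists>S'\<in>\<A> - {S}. S' \<subseteq> e)}"

lemma finite_private_edges [simp]: "finite V \<Longrightarrow> finite (private_edges V r \<A> S)"
  by (simp add: private_edges_def)

lemma finite_shared_edges [simp]: "finite V \<Longrightarrow> finite (shared_edges V r \<A> S)"
  by (simp add: shared_edges_def)

context
  fixes V :: "'a set" and \<A> :: "'a set set" and S :: "'a set" and r s :: nat
  assumes fin: "finite V" and fam: "\<A> \<subseteq> nsets V s" and S: "S \<in> \<A>" and sr: "s \<le> r"
begin

text \<open>Prepares the passage to the link of \<open>S\<close>, where another member
  \<open>S'\<close> becomes \<open>S' - S\<close>. This is nonempty because all members have the
  same size.\<close>

lemma link_basics:
  "S \<subseteq> V" "card S = s" "finite S" "finite (\<A> - {S})" "card (\<A> - {S}) = card \<A> - 1"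
  "card (V - S) = card V - s" "\<And>S'. S' \<in> \<A> - {S} \<Longrightarrow> S' - S \<noteq> {}"
proof -
  show S': "S \<subseteq> V" "card S = s" "finite S" using fam S by (auto simp: nsets_def)
  have "finite \<A>" using fam fin finite_subset by fastforce
  then show "finite (\<A> - {S})" "card (\<A> - {S}) = card \<A> - 1" using S by auto
  show "card (V - S) = card V - s" using S' by (simp add: card_Diff_subset)
  fix S' assume "S' \<in> \<A> - {S}"
  then show "S' - S \<noteq> {}"
    using fam S' by (auto simp: nsets_def dest: card_subset_eq)
qed

lemma card_private_edges:
  "card (private_edges V r \<A> S) = card {Z \<in> nsets (V - S) (r - s). \<forall>S'\<in>\<A> - {S}. \<not> S' - S \<subseteq> Z}"
proof -
  have "private_edges V r \<A> S =
      {e \<in> nsets V r. S \<subseteq> e \<and> (\<forall>S'\<in>\<A> - {S}. \<not> S' - S \<subseteq> e - S)}"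
    unfolding private_edges_def by blast
  then show ?thesis
    using card_extensions[OF fin, of S r "\<lambda>Z. \<forall>S'\<in>\<A> - {S}. \<not> S' - S \<subseteq> Z"] link_basics sr by simp
qed

lemma card_private_edges_ge: "(card V - s - (card \<A> - 1)) choose (r - s) \<le> card (private_edges V r \<A> S)"
  using card_avoiding_ge[of "V - S" "\<A> - {S}" "\<lambda>S'. S' - S" "r - s"] link_basics fin
  by (simp add: card_private_edges)

lemma private_edges_extremal:
  assumes "s < r" "card \<A> + r \<le> card V + 1"
    and "card (private_edges V r \<A> S) \<le> (card V - s - (card \<A> - 1)) choose (r - s)"
  shows "\<forall>S'\<in>\<A> - {S}. is_singleton (S' - S)" "inj_on (\<lambda>S'. S' - S) (\<A> - {S})"
proof -
  have "card \<A> > 0" using link_basics(4) S by (auto simp: card_gt_0_iff)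
  then have "card (\<A> - {S}) + (r - s) \<le> card (V - S)" using assms sr link_basics(5,6) by simp
  moreover have "Suc 0 \<le> r - s" using assms(1) by simp
  ultimately show "\<forall>S'\<in>\<A> - {S}. is_singleton (S' - S)" "inj_on (\<lambda>S'. S' - S) (\<A> - {S})"
    using avoiding_extremal[of "V - S" "\<A> - {S}" "\<lambda>S'. S' - S" "r - s"] link_basics fin assms
    by (simp_all add: card_private_edges)
qed

lemma card_shared_edges_le:
  assumes "s < r"
  shows "card (shared_edges V r \<A> S) \<le> (card \<A> - 1) * ((card V - s - 1) choose (r - s - 1))"
proof -
  have "shared_edges V r \<A> S =
      {e \<in> nsets V r. S \<subseteq> e \<and> (\<exists>S'\<in>\<A> - {S}. S' - S \<subseteq> e - S)}"
    unfolding shared_edges_def by blast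
  then have "card (shared_edges V r \<A> S) = card {Z \<in> nsets (V - S) (r - s). \<exists>S'\<in>\<A> - {S}. S' - S \<subseteq> Z}"
    using card_extensions[OF fin, of S r "\<lambda>Z. \<exists>S'\<in>\<A> - {S}. S' - S \<subseteq> Z"] link_basics sr by simp
  then show ?thesis
    using card_hitting_le[of "V - S" "\<A> - {S}" "\<lambda>S'. S' - S" "r - s"] link_basics fin assms
      Suc_leI[of 0 "r - s"] by simp
qed

lemma card_private_shared:
  "card (private_edges V r \<A> S) + card (shared_edges V r \<A> S) = (card V - s) choose (r - s)"
proof -
  have "private_edges V r \<A> S \<union> shared_edges V r \<A> S = {e \<in> nsets V r. S \<subseteq> e}"
    "private_edges V r \<A> S \<inter> shared_edges V r \<A> S = {}"
    unfolding private_edges_def shared_edges_def by blast+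
  then show ?thesis
    using card_supersets[OF fin _ sr] fam S fin
    by (metis card_Un_disjoint finite_private_edges finite_shared_edges subsetD)
qed

end

text \<open>Each other member adds just one point to the core, and distinct members add distinct
  points. Avoiding them means missing exactly \<open>card \<A> - 1\<close> points of the
  link.\<close>

lemma card_private_edges_sunflower:
  assumes fin: "finite V" and fam: "\<A> \<subseteq> nsets V s" and S: "S \<in> \<A>" and sr: "s \<le> r"
    and core: "\<And>S'. S' \<in> \<A> \<Longrightarrow> C \<subseteq> S'" and C: "card C + 1 = s"
  shows "card (private_edges V r \<A> S) = (card V - s - (card \<A> - 1)) choose (r - s)"
proof -
  note basics = link_basics[OF fin fam S sr]
  define f where "f S' = the_elem (S' - C)" for S'
  have f: "S' = insert (f S') C" "f S' \<notin> C" "f S' \<in> V" if "S' \<in> \<A>" for S'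
  proof -
    have fS': "finite S'" "card S' = s" "S' \<subseteq> V" using that fam by (auto simp: nsets_def)
    then have "card (S' - C) = 1"
      using core[OF that] C by (simp add: card_Diff_subset finite_subset)
    then have "S' - C = {f S'}" by (metis card_1_singletonE f_def the_elem_eq)
    then show "S' = insert (f S') C" "f S' \<notin> C" "f S' \<in> V" using core[OF that] fS'(3) by auto
  qed
  have inj: "inj_on f \<A>" using f(1) by (metis inj_onI)
  have diff: "S' - S = {f S'}" if "S' \<in> \<A> - {S}" for S'
    using that f[of S'] f(1)[OF S] inj S by (auto dest: inj_onD)
  have sub: "f ` (\<A> - {S}) \<subseteq> V - S" using diff f(3) by blast
  have "{Z \<in> nsets (V - S) (r - s). \<forall>S'\<in>\<A> - {S}. \<not> S' - S \<subseteq> Z} = nsets (V - S - f ` (\<A> - {S})) (r - s)"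
    using diff by (auto simp: nsets_def)
  moreover have "card (V - S - f ` (\<A> - {S})) = card V - s - (card \<A> - 1)"
  proof -
    have "card (f ` (\<A> - {S})) = card \<A> - 1"
      using inj basics(5) by (simp add: card_image inj_on_diff)
    moreover have "finite (f ` (\<A> - {S}))" using basics(4) by (rule finite_imageI)
    ultimately show ?thesis using sub basics(6) by (simp add: card_Diff_subset)
  qed
  ultimately show ?thesis
    using card_private_edges[OF fin fam S sr] fin by (simp add: card_nsets)
qed

section \<open>Size of upper shadows and the extremal role of stars\<close>

lemma upper_shadow_remove:
  assumes "S \<in> \<A>" "finite \<A>"
  shows "card (upper_shadow n r \<A>) = card (upper_shadow n r (\<A> - {S})) + card (private_edges {1..n} r \<A> S)"
proof -
  have "upper_shadow n r \<A> = upper_shadow n r (\<A> - {S}) \<union> private_edges {1..n} r \<A> S"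
    "upper_shadow n r (\<A> - {S}) \<inter> private_edges {1..n} r \<A> S = {}"
    using assms(1) by (auto simp: upper_shadow_def private_edges_def)
  then show ?thesis by (simp add: card_Un_disjoint upper_shadow_def)
qed

text \<open>By Pascal's rule the increment of \<open>N\<close> is the lower bound for the private
  edges of one member in a family of \<open>t + 1\<close> sets. This matches the removal of one set
  from an upper shadow.\<close>

lemma N_Suc:
  assumes "s + t \<le> n" "s \<le> r"
  shows "N n (Suc t) r s = N n t r s + ((n - s - t) choose (r - s))"
proof -
  have "(n + 1 - s - t) choose (r + 1 - s) = ((n - s - t) choose (r - s)) + ((n - s - t) choose (r + 1 - s))"
    using assms by (simp add: Suc_diff_le)
  moreover have "(n + 1 - s - t) choose (r + 1 - s) \<le> (n + 1 - s) choose (r + 1 - s)"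
    by (intro binomial_right_mono) simp
  moreover have "n + 1 - s - Suc t = n - s - t" by simp
  ultimately show ?thesis unfolding N_def by simp
qed

lemma N_zero [simp]: "N n 0 r s = 0"
  by (simp add: N_def)

lemma N_le:
  assumes "s + t \<le> n + 1" "s \<le> r"
  shows "N n t r s \<le> t * ((n - s) choose (r - s))"
  using assms
proof (induction t)
  case (Suc t)
  have "(n - s - t) choose (r - s) \<le> (n - s) choose (r - s)"
    by (intro binomial_right_mono) simp
  with Suc show ?case using N_Suc[of s t n r] by simp
qed simp

lemma upper_shadow_ge:
  assumes "\<A> \<subseteq> nsets {1..n} s" "card \<A> + s \<le> n + 1" "s \<le> r"
  shows "N n (card \<A>) r s \<le> card (upper_shadow n r \<A>)"
proof -
  have "finite \<A>" using assms(1) finite_subset by fastforce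
  then show ?thesis using assms
  proof (induction "card \<A>" arbitrary: \<A>)
    case (Suc t)
    then obtain S where S: "S \<in> \<A>" by fastforce
    have t: "card (\<A> - {S}) = t" using S Suc.hyps(2) Suc.prems(1) by simp
    have "N n t r s \<le> card (upper_shadow n r (\<A> - {S}))"
      using Suc.hyps(1)[OF t[symmetric]] Suc.hyps(2) Suc.prems unfolding t by auto
    then show ?case
      using upper_shadow_remove[OF S] card_private_edges_ge[OF _ Suc.prems(2) S Suc.prems(4)]
        N_Suc[of s t n r] Suc.hyps(2)[symmetric] Suc.prems by simp
  qed simp
qed

text \<open>Pairwise intersections of size \<open>s - 1\<close> also occur among the
  \<open>s\<close>-subsets of an \<open>(s + 1)\<close>-set. For three or more of those, the other
  members all add the same point to \<open>S\<close>, which injectivity rules out.\<close>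

lemma pairwise_exchange_imp_star:
  assumes fam: "\<A> \<subseteq> nsets {1..n} s" and "\<A> \<noteq> {}"
    and single: "\<And>S S'. S \<in> \<A> \<Longrightarrow> S' \<in> \<A> - {S} \<Longrightarrow> is_singleton (S' - S)"
    and inj: "\<And>S. S \<in> \<A> \<Longrightarrow> inj_on (\<lambda>S'. S' - S) (\<A> - {S})"
  shows "star_configuration n s \<A>"
proof -
  obtain S where S: "S \<in> \<A>" using assms(2) by blast
  have card: "card S' = s" "finite S'" if "S' \<in> \<A>" for S'
    using that fam by (auto simp: nsets_def)
  have inter: "card (S \<inter> S') = s - 1" if "S' \<in> \<A>" "S' \<noteq> S" for S'
  proof -
    have "card (S' - S) = 1" using single[OF S, of S'] that by (simp add: is_singleton_altdef)
    then show ?thesis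
      using card[OF that(1)] card_Diff_subset_Int[of S' S]
      by (metis Int_commute card_Int_Diff diff_add_inverse2)
  qed
  have "s - 1 \<le> card (\<Inter>\<A>)"
  proof (cases "\<A> = {S}")
    case True
    then show ?thesis using card[OF S] by simp
  next
    case False
    then obtain S1 where S1: "S1 \<in> \<A>" "S1 \<noteq> S" using S by blast
    have "S \<inter> S1 \<subseteq> S2" if S2: "S2 \<in> \<A>" for S2
    proof (cases "S2 = S \<or> S2 = S1")
      case False
      obtain x y z where xyz: "S1 - S = {x}" "S2 - S = {y}" "S2 - S1 = {z}"
        using single S S1 S2 False by (metis Diff_iff empty_iff insert_iff is_singletonE)
      have "x \<noteq> y" using inj[OF S] S1 S2 False xyz by (metis (no_types, lifting) Diff_iff empty_iff insert_iff inj_onD)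
      have y: "y \<in> S2" "y \<notin> S" using xyz(2) by auto
      moreover have "y \<notin> S1" using xyz(1) y(2) \<open>x \<noteq> y\<close> by auto
      \<comment> \<open>As \<open>y\<close> lies outside both \<open>S\<close> and
        \<open>S1\<close>, it is the only point of \<open>S2\<close> outside \<open>S1\<close>.
        Hence \<open>S2\<close> meets \<open>S\<close> inside \<open>S1\<close>, and equal sizes
        force the same core.\<close>
      ultimately have "z = y" using xyz(3) by auto
      then have "S \<inter> S2 \<subseteq> S \<inter> S1" using xyz(3) y(2) by auto
      then have "S \<inter> S2 = S \<inter> S1"
        using inter S1 S2 False card[OF S] by (intro card_subset_eq) auto
      then show ?thesis by blast
    qed auto
    then have "S \<inter> S1 \<subseteq> \<Inter>\<A>" by blast
    moreover have "finite (\<Inter>\<A>)" using S card(2)[OF S] by (metis Inter_lower finite_subset)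
    ultimately show ?thesis using inter[OF S1] by (metis card_mono)
  qed
  then show ?thesis using fam by (simp add: star_configuration_def)
qed

text \<open>Any member may be the first to be removed. The rest already accounts for the value of
  \<open>N\<close> at one set fewer, so every member has as few private edges as possible.\<close>

lemma upper_shadow_extremal:
  assumes fam: "\<A> \<subseteq> nsets {1..n} s" and ne: "\<A> \<noteq> {}" and "card \<A> + r \<le> n + 1" "s < r"
    and le: "card (upper_shadow n r \<A>) \<le> N n (card \<A>) r s"
  shows "star_configuration n s \<A>"
proof -
  have fin: "finite \<A>" using fam finite_subset by fastforce
  have tight: "card (private_edges {1..n} r \<A> S) \<le> (n - s - (card \<A> - 1)) choose (r - s)"
    if S: "S \<in> \<A>" for S
  proof -
    obtain t where t: "card \<A> = Suc t" using fin ne by (cases "card \<A>") auto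
    have "N n t r s \<le> card (upper_shadow n r (\<A> - {S}))"
      using upper_shadow_ge[of "\<A> - {S}" n s r] fam fin S assms t by auto
    then show ?thesis
      using upper_shadow_remove[OF S fin, of n r] le N_Suc[of s t n r] t assms by simp
  qed
  show ?thesis
    using fam ne private_edges_extremal[OF _ fam _ _ \<open>s < r\<close>] tight assms
    by (intro pairwise_exchange_imp_star) auto
qed

lemma card_upper_shadow_star:
  assumes star: "star_configuration n s \<A>" and "card \<A> + s \<le> n + 1" "1 \<le> s" "s \<le> r"
  shows "card (upper_shadow n r \<A>) = N n (card \<A>) r s"
proof -
  \<comment> \<open>The core is fixed before the induction because \<open>star_configuration\<close>
    is not inherited down to the empty family when \<open>s > 1\<close>: its intersection is
    \<open>UNIV\<close>, whose \<open>card\<close> is 0.\<close>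
  obtain C where C: "C \<subseteq> \<Inter>\<A>" "card C = s - 1"
    using star obtain_subset_with_card_n unfolding star_configuration_def by metis
  have fam: "\<A> \<subseteq> nsets {1..n} s" using star by (simp add: star_configuration_def)
  then have "finite \<A>" using finite_subset by fastforce
  moreover have "\<And>S. S \<in> \<A> \<Longrightarrow> C \<subseteq> S" using C by blast
  ultimately show ?thesis using fam assms(2)
  proof (induction "card \<A>" arbitrary: \<A>)
    case 0
    then show ?case by (simp add: upper_shadow_def)
  next
    case (Suc t)
    then obtain S where S: "S \<in> \<A>" by fastforce
    have t: "card (\<A> - {S}) = t" using S Suc.hyps(2) Suc.prems(1) by simp
    have "card (upper_shadow n r (\<A> - {S})) = N n t r s"
      using Suc.hyps(1)[OF t[symmetric]] Suc.hyps(2) Suc.prems unfolding t by auto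
    moreover have "card (private_edges {1..n} r \<A> S) = (n - s - (card \<A> - 1)) choose (r - s)"
      using card_private_edges_sunflower[of "{1..n}" \<A> s S r C] Suc.prems S C assms by simp
    ultimately show ?case
      using upper_shadow_remove[OF S, of n r] N_Suc[of s t n r] Suc.hyps(2)[symmetric] Suc.prems assms by simp
  qed
qed

section \<open>The support of a family of kernel vectors\<close>

text \<open>The data delivered by \<open>inclusion_matrix_kernel\<close>. From here on the argument
  is purely combinatorial and no longer mentions rank.\<close>

locale kernel_family =
  fixes n r s :: nat and F T :: "nat set set" and w :: "nat set \<Rightarrow> nat set \<Rightarrow> real"
  assumes sr: "s < r"
    and F: "F \<subseteq> nsets {1..n} r"
    and T: "T \<subseteq> nsets {1..n} s"
    and diag: "\<And>S. S \<in> T \<Longrightarrow> w S S = 1"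
    and off_diag: "\<And>S S'. S \<in> T \<Longrightarrow> S' \<in> T - {S} \<Longrightarrow> w S S' = 0"
    and kernel: "\<And>S e. S \<in> T \<Longrightarrow> e \<in> nsets {1..n} r - F \<Longrightarrow> sum (w S) (nsets e s) = 0"
begin

definition H :: "nat set set" where
  "H = {S' \<in> nsets {1..n} s. \<exists>S\<in>T. w S S' \<noteq> 0}"

lemma H_subset: "H \<subseteq> nsets {1..n} s"
  by (auto simp: H_def)

lemma T_subset_H: "T \<subseteq> H"
proof
  fix S assume "S \<in> T"
  moreover from this have "w S S \<noteq> 0" using diag by simp
  ultimately show "S \<in> H" using T unfolding H_def by blast
qed

lemma finite_sets: "finite F" "finite T" "finite H"
proof -
  show "finite F" by (rule finite_subset[OF F]) simp
  show "finite T" by (rule finite_subset[OF T]) simp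
  show "finite H" by (rule finite_subset[OF H_subset]) simp
qed

text \<open>
  Each \<open>(r + s)\<close>-set containing a member of \<open>H\<close> contains an edge of \<open>F\<close>, since the inclusion
  matrix of all \<open>r\<close>-subsets of an \<open>(r + s)\<close>-set is injective. Counting such sets from both sides
  bounds \<open>H\<close>.
\<close>

lemma card_H_le:
  assumes n: "r + s \<le> n" and cF: "card F \<le> card T * ((n - s) choose (r - s))"
  shows "card H \<le> ((r + s) choose s) * (r choose s) * card T"
proof -
  let ?W = "nsets {1..n} (r + s)"
  define \<X> where "\<X> = {X \<in> ?W. \<exists>S\<in>H. S \<subseteq> X}"
  have fX: "finite \<X>" by (simp add: \<X>_def)
  have "\<X> \<subseteq> (\<Union>e\<in>F. {X \<in> ?W. e \<subseteq> X})"
  proof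
    fix X assume X: "X \<in> \<X>"
    then obtain S' where S': "S' \<in> H" "S' \<subseteq> X" and XW: "X \<in> ?W" by (auto simp: \<X>_def)
    then obtain S where S: "S \<in> T" "w S S' \<noteq> 0" by (auto simp: H_def)
    have X': "finite X" "card X = r + s" "X \<subseteq> {1..n}" using XW by (auto simp: nsets_def)
    have S'X: "S' \<in> nsets X s" using S' by (auto simp: H_def nsets_def)
    have "\<exists>e\<in>nsets X r. sum (w S) (nsets e s) \<noteq> 0"
    proof (rule ccontr)
      assume "\<not> ?thesis"
      then have "\<And>e. e \<in> nsets X r \<Longrightarrow> sum (w S) (nsets e s) = 0" by blast
      then have "w S S' = 0"
        using inclusion_matrix_injective[of X r s "w S" S'] X' S'X sr by simp
      then show False using S(2) by simp
    qed
    then obtain e where e: "e \<in> nsets X r" "sum (w S) (nsets e s) \<noteq> 0" by blast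
    have "e \<in> nsets {1..n} r" using e(1) X' by (auto simp: nsets_def)
    then have "e \<in> F" using kernel[OF S(1)] e(2) by blast
    moreover have "e \<subseteq> X" using e(1) by (simp add: nsets_def)
    ultimately show "X \<in> (\<Union>e\<in>F. {X \<in> ?W. e \<subseteq> X})" using XW by blast
  qed
  then have "card \<X> \<le> card (\<Union>e\<in>F. {X \<in> ?W. e \<subseteq> X})"
    using finite_sets by (intro card_mono) auto
  also have "\<dots> \<le> (\<Sum>e\<in>F. card {X \<in> ?W. e \<subseteq> X})" by (rule card_UN_le[OF finite_sets(1)])
  also have "\<dots> = (\<Sum>e\<in>F. (n - r) choose s)"
  proof (rule sum.cong)
    fix e assume "e \<in> F"
    then have "e \<in> nsets {1..n} r" using F by blast
    then show "card {X \<in> ?W. e \<subseteq> X} = (n - r) choose s"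
      using card_supersets[of "{1..n}" e r "r + s"] by simp
  qed simp
  finally have X_le: "card \<X> \<le> card F * ((n - r) choose s)" by simp
  \<comment> \<open>Double counting of the pairs of a member of \<open>H\<close> and a set of
    \<open>\<X>\<close> above it.\<close>
  have "card H * ((n - s) choose r) = (\<Sum>S\<in>H. card {X \<in> \<X>. S \<subseteq> X})"
  proof -
    have "card {X \<in> \<X>. S \<subseteq> X} = (n - s) choose r" if S: "S \<in> H" for S
    proof -
      have "{X \<in> \<X>. S \<subseteq> X} = {X \<in> ?W. S \<subseteq> X}" using S by (auto simp: \<X>_def)
      moreover have "S \<in> nsets {1..n} s" using S H_subset by blast
      ultimately show ?thesis using card_supersets[of "{1..n}" S s "r + s"] by simp
    qed
    then show ?thesis by simp
  qed
  also have "\<dots> = (\<Sum>X\<in>\<X>. card {S \<in> H. S \<subseteq> X})"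
    using sum.swap_restrict[OF finite_sets(3) fX, of "\<lambda>_ _. 1::nat" "(\<subseteq>)"] by simp
  also have "\<dots> \<le> (\<Sum>X\<in>\<X>. (r + s) choose s)"
  proof (rule sum_mono)
    fix X assume "X \<in> \<X>"
    then have X: "finite X" "card X = r + s" by (auto simp: \<X>_def nsets_def)
    have "{S \<in> H. S \<subseteq> X} \<subseteq> nsets X s" using H_subset by (auto simp: nsets_def)
    then have "card {S \<in> H. S \<subseteq> X} \<le> card (nsets X s)" using X by (intro card_mono) auto
    then show "card {S \<in> H. S \<subseteq> X} \<le> (r + s) choose s" using X by (simp add: card_nsets)
  qed
  also have "\<dots> = card \<X> * ((r + s) choose s)" by simp
  also have "\<dots> \<le> card T * ((n - s) choose (r - s)) * ((n - r) choose s) * ((r + s) choose s)"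
  proof (rule mult_right_mono)
    show "card \<X> \<le> card T * ((n - s) choose (r - s)) * ((n - r) choose s)"
      by (rule order_trans[OF X_le mult_right_mono[OF cF]]) simp
  qed simp
  also have "\<dots> = card T * ((r + s) choose s) * (((n - s) choose (r - s)) * ((n - r) choose s))"
    by simp
  \<comment> \<open>Both sides count chains of an \<open>r\<close>-set and an
    \<open>(r + s)\<close>-set above a fixed \<open>s\<close>-set, choosing either the smaller or
    the larger set first. The factor depending on \<open>n\<close> then cancels.\<close>
  also have "((n - s) choose (r - s)) * ((n - r) choose s) = ((n - s) choose r) * (r choose s)"
  proof -
    have "((n - s) choose r) * (r choose (r - s)) =
        ((n - s) choose (r - s)) * ((n - s - (r - s)) choose (r - (r - s)))"
      using n sr by (intro choose_mult) auto
    moreover have "r choose (r - s) = r choose s" using sr by (metis binomial_symmetric less_imp_le)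
    moreover have "n - s - (r - s) = n - r" "r - (r - s) = s" using sr n by auto
    ultimately show ?thesis by simp
  qed
  finally have "card H * ((n - s) choose r) \<le>
      (((r + s) choose s) * (r choose s) * card T) * ((n - s) choose r)" by (simp add: algebra_simps)
  moreover have "0 < (n - s) choose r" using n by simp
  ultimately show ?thesis by simp
qed

text \<open>All \<open>s\<close>-subsets of such a set other than \<open>S'\<close> lie outside
  \<open>H\<close>. The sum of a vector that is nonzero at \<open>S'\<close> therefore reduces to
  that one entry.\<close>

lemma private_edges_subset:
  assumes "S' \<in> H"
  shows "private_edges {1..n} r H S' \<subseteq> F"
proof
  fix e assume e: "e \<in> private_edges {1..n} r H S'"
  then have er: "e \<in> nsets {1..n} r" "S' \<subseteq> e" and only: "\<And>S''. S'' \<in> H - {S'} \<Longrightarrow> \<not> S'' \<subseteq> e"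
    by (auto simp: private_edges_def)
  obtain S where S: "S \<in> T" "w S S' \<noteq> 0" using assms by (auto simp: H_def)
  have fe: "finite e" "e \<subseteq> {1..n}" using er by (auto simp: nsets_def)
  have S'e: "S' \<in> nsets e s" using assms er by (auto simp: H_def nsets_def)
  have "w S S'' = 0" if "S'' \<in> nsets e s - {S'}" for S''
  proof -
    have "S'' \<in> nsets {1..n} s" "S'' \<subseteq> e" "S'' \<noteq> S'" using that fe by (auto simp: nsets_def)
    then show ?thesis using only[of S''] S(1) unfolding H_def by blast
  qed
  then have "sum (w S) (nsets e s - {S'}) = 0" by (intro sum.neutral) blast
  then have "sum (w S) (nsets e s) = w S S'"
    using fe S'e by (simp add: sum.remove)
  then show "e \<in> F" using kernel[OF S(1), of e] S(2) er(1) by force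
qed

text \<open>A set above \<open>S \<in> T\<close> that is not shared contains no member of
  \<open>H - T\<close>. Other members of \<open>T\<close> contribute 0 to the sum of
  \<open>w S\<close>, which is thus 1.\<close>

lemma upper_shadow_diff_subset:
  "upper_shadow n r T - (\<Union>S\<in>H - T. shared_edges {1..n} r H S) \<subseteq> F"
proof
  fix e assume e: "e \<in> upper_shadow n r T - (\<Union>S\<in>H - T. shared_edges {1..n} r H S)"
  then obtain S where S: "S \<in> T" "S \<subseteq> e" and er: "e \<in> nsets {1..n} r"
    by (auto simp: upper_shadow_def)
  have fe: "finite e" "e \<subseteq> {1..n}" using er by (auto simp: nsets_def)
  have none: "\<not> S' \<subseteq> e" if "S' \<in> H - T" for S'
  proof
    assume "S' \<subseteq> e"
    moreover have "S \<in> H - {S'}" using S(1) T_subset_H that by blast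
    ultimately have "e \<in> shared_edges {1..n} r H S'" using er S(2) by (auto simp: shared_edges_def)
    then show False using e that by blast
  qed
  have Se: "S \<in> nsets e s" using S T by (auto simp: nsets_def)
  have "w S S' = 0" if "S' \<in> nsets e s - {S}" for S'
  proof (cases "S' \<in> T")
    case True
    then show ?thesis using off_diag[OF S(1)] that by blast
  next
    case False
    have "S' \<in> nsets {1..n} s" "S' \<subseteq> e" using that fe by (auto simp: nsets_def)
    then show ?thesis using none[of S'] False S(1) unfolding H_def by blast
  qed
  then have "sum (w S) (nsets e s - {S}) = 0" by (intro sum.neutral) blast
  then have "sum (w S) (nsets e s) = 1"
    using fe Se diag[OF S(1)] by (simp add: sum.remove)
  then show "e \<in> F" using kernel[OF S(1), of e] er by force
qed

text \<open>By \<open>small\<close>, fewer than half of the \<open>r\<close>-sets above a member of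
  \<open>H\<close> are shared. The private edges of \<open>H - T\<close> are pairwise disjoint and
  lie outside the shadow of \<open>T\<close>, so they outnumber the shadow sets that may be
  lost.\<close>

lemma card_upper_shadow_less:
  assumes small: "2 * ((card H - 1) * ((n - s - 1) choose (r - s - 1))) < (n - s) choose (r - s)"
    and ne: "H \<noteq> T"
  shows "card (upper_shadow n r T) < card F"
proof -
  define b where "b = (card H - 1) * ((n - s - 1) choose (r - s - 1))"
  let ?P = "\<Union>S\<in>H - T. private_edges {1..n} r H S" and ?Q = "\<Union>S\<in>H - T. shared_edges {1..n} r H S"
  have fin: "finite (H - T)" using finite_sets by simp
  have shared: "card (shared_edges {1..n} r H S) \<le> b" if "S \<in> H" for S
    using card_shared_edges_le[OF _ H_subset that _ sr] sr by (simp add: b_def)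
  have "card ?P = (\<Sum>S\<in>H - T. card (private_edges {1..n} r H S))"
    using fin by (intro card_UN_disjoint) (auto simp: private_edges_def)
  moreover have "card ?Q \<le> (\<Sum>S\<in>H - T. card (shared_edges {1..n} r H S))"
    by (rule card_UN_le[OF fin])
  moreover have "(\<Sum>S\<in>H - T. card (shared_edges {1..n} r H S)) < (\<Sum>S\<in>H - T. card (private_edges {1..n} r H S))"
  proof (rule sum_strict_mono[OF fin])
    show "H - T \<noteq> {}" using ne T_subset_H by blast
    fix S assume "S \<in> H - T"
    then have S: "S \<in> H" by simp
    show "card (shared_edges {1..n} r H S) < card (private_edges {1..n} r H S)"
      using card_private_shared[OF _ H_subset S, of r] shared[OF S] small sr by (simp add: b_def)
  qed
  ultimately have QP: "card ?Q < card ?P" by simp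
  have finU: "finite (upper_shadow n r T)" by (simp add: upper_shadow_def)
  have finQ: "finite ?Q" "finite ?P" using fin by auto
  have "card (upper_shadow n r T) \<le> card (upper_shadow n r T - ?Q) + card ?Q"
    using diff_card_le_card_Diff[OF finQ(1), of "upper_shadow n r T"] by simp
  also have "\<dots> < card (upper_shadow n r T - ?Q) + card ?P" using QP by simp
  also have "\<dots> = card ((upper_shadow n r T - ?Q) \<union> ?P)"
  proof (rule card_Un_disjoint[symmetric])
    show "(upper_shadow n r T - ?Q) \<inter> ?P = {}"
      using T_subset_H by (auto simp: upper_shadow_def private_edges_def)
  qed (use finU finQ in auto)
  also have "\<dots> \<le> card F"
  proof (rule card_mono[OF finite_sets(1)])
    show "(upper_shadow n r T - ?Q) \<union> ?P \<subseteq> F"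
      using upper_shadow_diff_subset private_edges_subset by blast
  qed
  finally show ?thesis .
qed

lemma card_ge_and_extremal:
  assumes t: "1 \<le> card T" and n: "4 * r \<le> n"
    and small: "4 * r * (((r + s) choose s) * (r choose s) * card T) \<le> n"
    and le: "card F \<le> N n (card T) r s"
  shows "card F = N n (card T) r s" "star_configuration n s T" "F = upper_shadow n r T"
proof -
  define K where "K = ((r + s) choose s) * (r choose s)"
  have "0 < K" using sr by (simp add: K_def)
  have small': "4 * r * (K * card T) \<le> n" using small by (simp add: K_def)
  have "card T \<le> K * card T" using \<open>0 < K\<close> by simp
  also have "\<dots> \<le> r * (K * card T)" using sr by simp
  finally have "4 * card T \<le> 4 * (r * (K * card T))" by simp
  also have "\<dots> \<le> n" using small' by (simp only: mult.assoc)
  finally have tn: "4 * card T \<le> n" .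
  have "N n (card T) r s \<le> card T * ((n - s) choose (r - s))"
    using tn n sr by (intro N_le) auto
  then have hK: "card H \<le> K * card T"
    using card_H_le le n sr by (simp add: K_def)
  have h: "1 \<le> card H" using t T_subset_H finite_sets card_mono[of H T] by linarith
  have "4 * r * card H \<le> n"
    by (rule order_trans[OF mult_left_mono[OF hK] small']) simp
  then have "4 * (r * card H) \<le> n" by (simp only: mult.assoc)
  moreover have "(card H - 1) * (r - s) < card H * r"
    using h sr by (intro mult_less_le_imp_less) auto
  \<comment> \<open>The left side is below \<open>2 * (r * card H)\<close>, at most half of
    \<open>n\<close>, while \<open>s < r\<close> and \<open>4 * r \<le> n\<close> keep
    \<open>n - s\<close> above half of \<open>n\<close>. The identity \<open>absorb\<close> turns
    this into the required gap between binomials.\<close>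
  ultimately have lt: "2 * ((card H - 1) * (r - s)) < n - s" using n sr by (simp add: mult.commute)
  have absorb: "(r - s) * ((n - s) choose (r - s)) = (n - s) * ((n - s - 1) choose (r - s - 1))"
    using sr by (intro times_binomial_minus1_eq) simp
  have pos: "0 < (n - s - 1) choose (r - s - 1)" using n sr by simp
  have "(r - s) * (2 * ((card H - 1) * ((n - s - 1) choose (r - s - 1)))) =
      2 * ((card H - 1) * (r - s)) * ((n - s - 1) choose (r - s - 1))" by simp
  also have "\<dots> < (n - s) * ((n - s - 1) choose (r - s - 1))" using lt pos by simp
  also have "\<dots> = (r - s) * ((n - s) choose (r - s))" using absorb by simp
  finally have gap: "2 * ((card H - 1) * ((n - s - 1) choose (r - s - 1))) < (n - s) choose (r - s)"
    by simp
  have ge: "N n (card T) r s \<le> card (upper_shadow n r T)"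
    using upper_shadow_ge[OF T, of r] tn n sr by simp
  \<comment> \<open>Otherwise \<open>N\<close> is at most the shadow, which is strictly smaller than
    \<open>F\<close>, against \<open>le\<close>.\<close>
  have HT: "H = T" using card_upper_shadow_less[OF gap] ge le by (metis leD order_trans)
  then have sub: "upper_shadow n r T \<subseteq> F" using upper_shadow_diff_subset by simp
  then have "card (upper_shadow n r T) \<le> card F" using finite_sets by (intro card_mono)
  then have eq: "card F = N n (card T) r s" "card (upper_shadow n r T) = card F" using ge le by auto
  show "card F = N n (card T) r s" by (rule eq)
  show "F = upper_shadow n r T" using sub eq(2) finite_sets card_subset_eq by metis
  show "star_configuration n s T"
    using T t tn n sr eq by (intro upper_shadow_extremal[of T n s r]) auto
qed

end

section \<open>Choice of the constants and both directions of the characterization\<close>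

theorem theorem16:
  fixes r s :: nat
  assumes "1 \<le> s" and "s < r"
  shows "\<exists>(c0::real) (n0::nat). c0 > 0 \<and> n0 > 0 \<and>
    (\<forall>(n::nat) (t::nat) F. n \<ge> n0 \<longrightarrow> 1 \<le> t \<longrightarrow> real t \<le> c0 * real n \<longrightarrow> F \<subseteq> nsets {1..n} r \<longrightarrow>
      (card F < N n t r s \<longrightarrow>
         int (mat_rank (inclusion_matrix n s (nsets {1..n} r - F))) > int (n choose s) - int t) \<and>
      ((card F = N n t r s \<and>
         int (mat_rank (inclusion_matrix n s (nsets {1..n} r - F))) \<le> int (n choose s) - int t)
       \<longleftrightarrow> (\<exists>\<S>. star_configuration n s \<S> \<and> card \<S> = t \<and> F = upper_shadow n r \<S>)))"
proof -
  \<comment> \<open>With \<open>c0 = 1 / M\<close>, the bound on \<open>t\<close> is exactly the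
    hypothesis \<open>small\<close> of \<open>card_ge_and_extremal\<close>.\<close>
  define M where "M = 4 * r * (((r + s) choose s) * (r choose s))"
  have M: "0 < M" using assms by (simp add: M_def)
  have main: "(card F < N n t r s \<longrightarrow> int (mat_rank (inclusion_matrix n s (nsets {1..n} r - F))) > int (n choose s) - int t) \<and>
      ((card F = N n t r s \<and> int (mat_rank (inclusion_matrix n s (nsets {1..n} r - F))) \<le> int (n choose s) - int t) \<longleftrightarrow>
        (\<exists>\<S>. star_configuration n s \<S> \<and> card \<S> = t \<and> F = upper_shadow n r \<S>))"
    (is "(_ \<longrightarrow> _) \<and> (?L \<longleftrightarrow> ?R)")
    if n: "4 * r \<le> n" and t: "1 \<le> t" "real t \<le> 1 / real M * real n" and F: "F \<subseteq> nsets {1..n} r"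
    for n t F
  proof -
    have "real (M * t) \<le> real n" using t(2) M by (simp add: field_simps)
    then have Mt: "M * t \<le> n" by linarith
    \<comment> \<open>Assuming only \<open>\<le>\<close> for the number of edges yields (i) by
      contraposition, since equality is forced, and the forward half of (ii) at once.\<close>
    have low_rank: "card F = N n t r s \<and> (\<exists>\<S>. star_configuration n s \<S> \<and> card \<S> = t \<and> F = upper_shadow n r \<S>)"
      if rk: "int (mat_rank (inclusion_matrix n s (nsets {1..n} r - F))) \<le> int (n choose s) - int t" and le: "card F \<le> N n t r s"
    proof -
      have "mat_rank (inclusion_matrix n s (nsets {1..n} r - F)) + t \<le> n choose s"
        using rk by linarith
      then obtain T w where T_sub: "T \<subseteq> nsets {1..n} s" and cT: "card T = t"
        and w: "\<And>S. S \<in> T \<Longrightarrow> w S S = (1::real)"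
          "\<And>S S'. S \<in> T \<Longrightarrow> S' \<in> T - {S} \<Longrightarrow> w S S' = 0"
          "\<And>S e. S \<in> T \<Longrightarrow> e \<in> nsets {1..n} r - F \<Longrightarrow> sum (w S) (nsets e s) = 0"
        by (rule inclusion_matrix_kernel[OF F]) (assumption | rule that)+
      interpret kernel_family n r s F T w
        by unfold_locales (use assms F T_sub w in auto)
      have "4 * r * (((r + s) choose s) * (r choose s) * card T) \<le> n"
        using Mt cT by (simp add: M_def mult.assoc)
      then show ?thesis
        using card_ge_and_extremal assms t(1) n le cT T_sub by metis
    qed
    have "?L" if ?R
    proof -
      obtain \<S> where star: "star_configuration n s \<S>" "card \<S> = t" "F = upper_shadow n r \<S>"
        using \<open>?R\<close> by blast
      have "1 \<le> ((r + s) choose s) * (r choose s)" using assms by (simp add: Suc_le_eq)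
      then have "4 * 1 * 1 \<le> M" using assms unfolding M_def by (intro mult_le_mono) auto
      then have "4 * t \<le> M * t" by simp
      then have "t + s \<le> n + 1" using Mt n assms by linarith
      then have "card F = N n t r s" using card_upper_shadow_star[OF star(1)] star assms by simp
      \<comment> \<open>No edge of the complement contains a member of \<open>\<S>\<close>, so these
        \<open>t\<close> columns vanish.\<close>
      moreover have "mat_rank (inclusion_matrix n s (nsets {1..n} r - F)) + card \<S> \<le> n choose s"
      proof (rule inclusion_matrix_rank_le)
        show "finite (nsets {1..n} r - F)" by simp
        show "\<S> \<subseteq> nsets {1..n} s" using star(1) by (simp add: star_configuration_def)
        show "\<not> S \<subseteq> e" if "S \<in> \<S>" "e \<in> nsets {1..n} r - F" for S e
          using that star(3) by (auto simp: upper_shadow_def)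
      qed (simp add: nsets_def)
      ultimately show ?L using star(2) by linarith
    qed
    then show ?thesis using low_rank by fastforce
  qed
  show ?thesis
    by (intro exI[of _ "1 / real M"] exI[of _ "4 * r"] conjI allI impI)
      (use M assms main in auto)
qed

end
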